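(* Let $q\ge 3$ be a prime power, let $X\subset\mathbb{P}^3(\mathbb{F}_q)$ be a hyperbolic quadric, and let $\mathcal{Q}'$ be a quadric in $\mathbb{P}^3(\mathbb{F}_q)$ whose defining form is not proportional to that of $X$. Then the number of points of $\mathbb{P}^3(\mathbb{F}_q)$ lying on both $X$ and $\mathcal{Q}'$ satisfies $$\#(X\cap \mathcal{Q}')(\mathbb{F}_q)=4q,\quad\text{or}\quad \#(X\cap \mathcal{Q}')(\mathbb{F}_q)=3q+1,\quad\text{or}\quad \#(X\cap \mathcal{Q}')(\mathbb{F}_q)\le 3q.$$
   Context: A quadric in $\mathbb{P}^3(\mathbb{F}_q)=PG(3,q)$ is the zero set $Z(f)$ of a nonzero form $f$ of degree 2 in $x_0,\dots,x_3$ over $\mathbb{F}_q$. It is non-degenerate if it has rank 4, the rank being the smallest number of indeterminates appearing in $f$ under any linear change of coordinates. A hyperbolic quadric is a non-degenerate quadric with $(q+1)^2$ points over $\mathbb{F}_q$. *)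

theory Defs
  imports "HOL-Analysis.Analysis" "HOL-Library.Poly_Mapping" "HOL-Library.Numeral_Type"
begin

(* Polynomials over 'a in indeterminates indexed by 'n: the monoid algebra of the exponent
   vectors, whose multiplication is the convolution product of Poly_Mapping. *)
type_synonym ('n, 'a) mpoly = "('n \<Rightarrow>\<^sub>0 nat) \<Rightarrow>\<^sub>0 'a"

definition const :: "'a::zero \<Rightarrow> ('n, 'a) mpoly" where
  "const c = Poly_Mapping.single 0 c"

definition var :: "'n \<Rightarrow> ('n, 'a::zero_neq_one) mpoly" where
  "var i = Poly_Mapping.single (Poly_Mapping.single i 1) 1"

definition mpoly_eval :: "('n::finite, 'a::field) mpoly \<Rightarrow> 'a ^ 'n \<Rightarrow> 'a" where
  "mpoly_eval f v =
     (\<Sum>m\<in>Poly_Mapping.keys f. Poly_Mapping.lookup f m * (\<Prod>i\<in>UNIV. (v $ i) ^ Poly_Mapping.lookup m i))"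

(* The zero polynomial is a form of every degree. *)
definition form :: "nat \<Rightarrow> ('n::finite, 'a::field) mpoly \<Rightarrow> bool" where
  "form d f \<longleftrightarrow> (\<forall>m\<in>Poly_Mapping.keys f. (\<Sum>i\<in>UNIV. Poly_Mapping.lookup m i) = d)"

definition indets :: "('n, 'a::zero) mpoly \<Rightarrow> 'n set" where
  "indets f = (\<Union>m\<in>Poly_Mapping.keys f. Poly_Mapping.keys m)"

(* Substitution of the linear form (sum over j of A $ i $ j times x_j) for each x_i. *)
definition linear_subst :: "'a ^ 'n ^ 'n \<Rightarrow> ('n::finite, 'a::field) mpoly \<Rightarrow> ('n, 'a) mpoly" where
  "linear_subst A f =
     (\<Sum>m\<in>Poly_Mapping.keys f. const (Poly_Mapping.lookup f m) *
        (\<Prod>i\<in>UNIV. (\<Sum>j\<in>UNIV. const (A $ i $ j) * var j) ^ Poly_Mapping.lookup m i))"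

definition form_rank :: "('n::finite, 'a::field) mpoly \<Rightarrow> nat" where
  "form_rank f = (LEAST r. \<exists>A :: 'a ^ 'n ^ 'n. invertible A \<and> r = card (indets (linear_subst A f)))"

(* Points of the projective space PG(n-1, 'a), n = CARD('n), are the lines through 0. *)
definition proj_points :: "('a::field ^ 'n::finite) set set" where
  "proj_points = {L. vec.subspace L \<and> vec.dim L = 1}"

definition zero_set :: "('n::finite, 'a::field) mpoly \<Rightarrow> ('a ^ 'n) set set" where
  "zero_set f = {L \<in> proj_points. \<forall>v\<in>L. mpoly_eval f v = 0}"

definition quadric_form :: "('n::finite, 'a::field) mpoly \<Rightarrow> bool" where
  "quadric_form f \<longleftrightarrow> form 2 f \<and> f \<noteq> 0"

definition proportional :: "('n::finite, 'a::field) mpoly \<Rightarrow> ('n, 'a) mpoly \<Rightarrow> bool" where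
  "proportional f g \<longleftrightarrow> (\<exists>c. c \<noteq> 0 \<and> g = const c * f)"

definition nondegenerate :: "(4, 'a::field) mpoly \<Rightarrow> bool" where
  "nondegenerate f \<longleftrightarrow> form_rank f = 4"

definition hyperbolic :: "(4, 'a::{field,finite}) mpoly \<Rightarrow> bool" where
  "hyperbolic f \<longleftrightarrow> quadric_form f \<and> nondegenerate f \<and> card (zero_set f) = (CARD('a) + 1)\<^sup>2"

end

(* Since f has no singular vector in its radical and more than q^2 + 1 points, splitting off two
   hyperbolic planes brings it to the shape ab + cd. Its points are then parametrised by pairs
   (r, w) of points of the projective line, and g becomes a form of bidegree (2,2) in (r, w), which
   is nonzero unless g is a multiple of f. For fixed r it vanishes for at most two values of w or
   identically; let k be the number of full lines obtained in this way. Three full lines would make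
   the form vanish, so k <= 2. Summing over r gives at most 2q + 2 points if k = 0 and at most
   3q + 1 if k = 1. If k = 2, the form is a product of a binary form in r and one in w, so all other
   fibres have the same number h <= 2 of zeros, giving 2(q + 1) + (q - 1)h points. *)

theory Submission
  imports Defs
begin

section \<open>Quadratic maps and forms of degree two\<close>

text \<open>No division by 2 occurs, so that characteristic 2 is covered; there Q is not determined
  by its polar form.\<close>

definition polar :: "('a::field ^ 'n \<Rightarrow> 'a) \<Rightarrow> 'a ^ 'n \<Rightarrow> 'a ^ 'n \<Rightarrow> 'a" where
  "polar Q x y = Q (x + y) - Q x - Q y"

text \<open>A coordinate-free quadratic form. Linearity on the left suffices because
  \<open>polar\<close> is symmetric.\<close>

locale quadratic_map =
  fixes Q :: "'a::field ^ 'n \<Rightarrow> 'a"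
  assumes scale: "Q (c *s x) = c\<^sup>2 * Q x"
    and polar_add_left: "polar Q (x + y) z = polar Q x z + polar Q y z"
    and polar_scale_left: "polar Q (c *s x) y = c * polar Q x y"
begin

lemma polar_commute: "polar Q x y = polar Q y x"
  by (simp add: polar_def add.commute)

lemma polar_add_right: "polar Q z (x + y) = polar Q z x + polar Q z y"
  by (metis polar_commute polar_add_left)

lemma polar_scale_right: "polar Q y (c *s x) = c * polar Q y x"
  by (metis polar_commute polar_scale_left)

lemma add: "Q (x + y) = Q x + Q y + polar Q x y"
  by (simp add: polar_def)

lemma zero [simp]: "Q 0 = 0"
  using scale[of 0 0] by simp

lemma polar_self: "polar Q x x = 2 * Q x"
proof -
  have "x + x = 2 *s x" by (simp add: vec_eq_iff)
  then have "Q (x + x) = 2\<^sup>2 * Q x" by (simp only: scale)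
  then show ?thesis by (simp add: polar_def)
qed

lemma polar_diff_left: "polar Q (x - y) z = polar Q x z - polar Q y z"
  using polar_add_left[of "x - y" y z] by simp

lemmas polar_linear = polar_add_left polar_add_right polar_scale_left polar_scale_right

end

section \<open>Evaluation of polynomials as a ring homomorphism\<close>

lemma mpoly_eval_superset:
  assumes "finite S" "Poly_Mapping.keys f \<subseteq> S"
  shows "mpoly_eval f v =
    (\<Sum>m\<in>S. Poly_Mapping.lookup f m * (\<Prod>i\<in>UNIV. (v $ i) ^ Poly_Mapping.lookup m i))"
  unfolding mpoly_eval_def
  by (rule sum.mono_neutral_left) (use assms in \<open>auto simp: in_keys_iff\<close>)

lemma mpoly_eval_zero [simp]: "mpoly_eval 0 v = 0"
  by (simp add: mpoly_eval_def)

lemma mpoly_eval_add: "mpoly_eval (f + g) v = mpoly_eval f v + mpoly_eval g v"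
proof -
  let ?S = "Poly_Mapping.keys f \<union> Poly_Mapping.keys g"
  have "finite ?S" by simp
  then show ?thesis
    using keys_add[of f g]
    by (simp add: mpoly_eval_superset[of ?S] lookup_add distrib_right sum.distrib)
qed

lemma mpoly_eval_sum: "mpoly_eval (sum F S) v = (\<Sum>x\<in>S. mpoly_eval (F x) v)"
  by (induction S rule: infinite_finite_induct) (auto simp: mpoly_eval_add)

lemma mpoly_eval_single:
  "mpoly_eval (Poly_Mapping.single m c) v = c * (\<Prod>i\<in>UNIV. (v $ i) ^ Poly_Mapping.lookup m i)"
  by (simp add: mpoly_eval_def)

lemma mpoly_eq_sum_single:
  "f = (\<Sum>m\<in>Poly_Mapping.keys f. Poly_Mapping.single m (Poly_Mapping.lookup f m))"
  by (rule poly_mapping_eqI) (auto simp: lookup_sum lookup_single when_def in_keys_iff)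

lemma mpoly_eval_mult:
  fixes f g :: "('n::finite, 'a::field) mpoly"
  shows "mpoly_eval (f * g) v = mpoly_eval f v * mpoly_eval g v"
proof -
  have "f * g = (\<Sum>m\<in>Poly_Mapping.keys f. Poly_Mapping.single m (Poly_Mapping.lookup f m)) *
      (\<Sum>n\<in>Poly_Mapping.keys g. Poly_Mapping.single n (Poly_Mapping.lookup g n))"
    by (rule arg_cong2[where f = "(*)", OF mpoly_eq_sum_single mpoly_eq_sum_single])
  also have "\<dots> = (\<Sum>m\<in>Poly_Mapping.keys f. \<Sum>n\<in>Poly_Mapping.keys g.
      Poly_Mapping.single (m + n) (Poly_Mapping.lookup f m * Poly_Mapping.lookup g n))"
    by (simp add: sum_product mult_single)
  finally have "f * g = \<dots>" .
  then show ?thesis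
    by (simp add: mpoly_eval_sum mpoly_eval_single mpoly_eval_def[of f] mpoly_eval_def[of g]
        sum_product lookup_add power_add prod.distrib mult_ac)
qed

lemma mpoly_eval_const: "mpoly_eval (const c) v = c"
  by (simp add: const_def mpoly_eval_single)

lemma mpoly_eval_one [simp]: "mpoly_eval 1 v = 1"
  using mpoly_eval_const[of 1 v] by (simp add: const_def)

lemma mpoly_eval_var: "mpoly_eval (var j) v = v $ j"
proof -
  have "(\<Prod>i\<in>UNIV. (v $ i) ^ (1 when j = i)) = (\<Prod>i\<in>UNIV. if j = i then v $ i else 1)"
    by (rule prod.cong) (auto simp: when_def)
  then show ?thesis
    by (simp add: var_def mpoly_eval_single lookup_single)
qed

lemma mpoly_eval_power:
  fixes f :: "('n::finite, 'a::field) mpoly"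
  shows "mpoly_eval (f ^ k) v = mpoly_eval f v ^ k"
  by (induction k) (auto simp: mpoly_eval_mult)

lemma mpoly_eval_prod:
  fixes F :: "'b \<Rightarrow> ('n::finite, 'a::field) mpoly"
  shows "mpoly_eval (prod F S) v = (\<Prod>x\<in>S. mpoly_eval (F x) v)"
  by (induction S rule: infinite_finite_induct) (auto simp: mpoly_eval_mult)

lemma mpoly_eval_linear_subst: "mpoly_eval (linear_subst A f) v = mpoly_eval f (A *v v)"
  by (simp add: linear_subst_def mpoly_eval_sum mpoly_eval_mult mpoly_eval_const mpoly_eval_prod
      mpoly_eval_power mpoly_eval_var mpoly_eval_def[of f] matrix_vector_mult_def)

section \<open>Degrees of sums, products and linear substitutions\<close>

lemma form_sum: "(\<And>x. x \<in> S \<Longrightarrow> form d (F x)) \<Longrightarrow> form d (sum F S)"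
proof (induction S rule: infinite_finite_induct)
  case (insert x S)
  then show ?case
    using keys_add[of "F x" "sum F S"] unfolding form_def by (auto simp: subset_iff)
qed (auto simp: form_def)

lemma form_mult:
  fixes f g :: "('n::finite, 'a::field) mpoly"
  assumes "form d f" "form e g"
  shows "form (d + e) (f * g)"
  unfolding form_def
proof
  fix m assume "m \<in> Poly_Mapping.keys (f * g)"
  then obtain a b where "m = a + b" "a \<in> Poly_Mapping.keys f" "b \<in> Poly_Mapping.keys g"
    using keys_mult[of f g] by auto
  then show "(\<Sum>i\<in>UNIV. Poly_Mapping.lookup m i) = d + e"
    using assms by (simp add: form_def lookup_add sum.distrib)
qed

lemma form_const: "form 0 (const c)"
  by (auto simp: form_def const_def)

lemma form_var: "form 1 (var i)"
  by (auto simp: form_def var_def lookup_single when_def)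

lemma form_power:
  fixes f :: "('n::finite, 'a::field) mpoly"
  assumes "form d f"
  shows "form (k * d) (f ^ k)"
proof (induction k)
  case 0
  show ?case using form_const[of 1] by (simp add: const_def)
next
  case (Suc k)
  then show ?case using form_mult[OF assms Suc] by simp
qed

lemma form_prod:
  fixes F :: "'b \<Rightarrow> ('n::finite, 'a::field) mpoly"
  assumes "finite S" "\<And>x. x \<in> S \<Longrightarrow> form (d x) (F x)"
  shows "form (\<Sum>x\<in>S. d x) (\<Prod>x\<in>S. F x)"
  using assms
proof (induction S rule: finite_induct)
  case empty
  show ?case using form_const[of 1] by (simp add: const_def)
next
  case (insert x S)
  then show ?case by (auto intro: form_mult)
qed

lemma form_linear_subst:
  assumes "form d f"
  shows "form d (linear_subst A f)"
  unfolding linear_subst_def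
proof (rule form_sum)
  fix m assume m: "m \<in> Poly_Mapping.keys f"
  have lin: "form 1 (\<Sum>j\<in>UNIV. const (A $ i $ j) * var j)" for i
    using form_mult[OF form_const form_var] by (intro form_sum) simp
  have "form (\<Sum>i\<in>UNIV. Poly_Mapping.lookup m i * 1)
      (\<Prod>i\<in>UNIV. (\<Sum>j\<in>UNIV. const (A $ i $ j) * var j) ^ Poly_Mapping.lookup m i)"
    by (intro form_prod form_power lin) auto
  then show "form d (const (Poly_Mapping.lookup f m) *
      (\<Prod>i\<in>UNIV. (\<Sum>j\<in>UNIV. const (A $ i $ j) * var j) ^ Poly_Mapping.lookup m i))"
    using form_mult[OF form_const] m assms by (fastforce simp: form_def)
qed

section \<open>Forms of degree two and their coefficients\<close>

definition pair_monom :: "'n \<Rightarrow> 'n \<Rightarrow> ('n \<Rightarrow>\<^sub>0 nat)" where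
  "pair_monom i j = Poly_Mapping.single i 1 + Poly_Mapping.single j 1"

lemma pair_monom_eq_iff:
  "pair_monom a b = pair_monom i j \<longleftrightarrow> a = i \<and> b = j \<or> a = j \<and> b = i"
proof
  assume "pair_monom a b = pair_monom i j"
  then have "Poly_Mapping.lookup (pair_monom a b) k = Poly_Mapping.lookup (pair_monom i j) k" for k by simp
  from this[of a] this[of b] this[of i] this[of j] show "a = i \<and> b = j \<or> a = j \<and> b = i"
    by (auto simp: pair_monom_def lookup_add lookup_single when_def split: if_splits)
qed (auto simp: pair_monom_def add.commute)

lemma degree_two_monom:
  fixes m :: "'n::finite \<Rightarrow>\<^sub>0 nat"
  assumes "(\<Sum>i\<in>UNIV. Poly_Mapping.lookup m i) = 2"
  obtains i j where "m = pair_monom i j"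
proof -
  \<comment> \<open>A monomial of positive degree is divisible by some indeterminate. Splitting one
    off twice leaves a monomial of degree 0.\<close>
  have *: "\<exists>i n. (\<Sum>i\<in>UNIV. Poly_Mapping.lookup n i) = d \<and> m = Poly_Mapping.single i 1 + n"
    if "(\<Sum>i\<in>UNIV. Poly_Mapping.lookup m i) = Suc d" for m :: "'n \<Rightarrow>\<^sub>0 nat" and d
  proof -
    from that obtain i where i: "Poly_Mapping.lookup m i \<noteq> 0"
      by (metis nat.distinct(1) sum.neutral)
    have m: "m = Poly_Mapping.single i 1 + (m - Poly_Mapping.single i 1)"
      using i by (intro poly_mapping_eqI) (auto simp: lookup_add lookup_minus lookup_single when_def)
    have "(\<Sum>i\<in>UNIV. Poly_Mapping.lookup m i) =
        1 + (\<Sum>j\<in>UNIV. Poly_Mapping.lookup (m - Poly_Mapping.single i 1) j)"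
      by (subst m) (simp add: lookup_add lookup_single sum.distrib when_def)
    with m that show ?thesis by auto
  qed
  obtain i n where n: "(\<Sum>i\<in>UNIV. Poly_Mapping.lookup n i) = Suc 0" "m = Poly_Mapping.single i 1 + n"
    using *[of m "Suc 0"] assms by auto
  then obtain j k where "(\<Sum>i\<in>UNIV. Poly_Mapping.lookup k i) = 0" "n = Poly_Mapping.single j 1 + k"
    using *[of n 0] by auto
  then have "k = 0" "n = Poly_Mapping.single j 1 + k" by (auto intro: poly_mapping_eqI)
  then show thesis using n that by (simp add: pair_monom_def)
qed

text \<open>Ordering the two indeterminates of each monomial once and for all turns evaluation into
  a sum of products of two coordinates, from which the polar form can be read off.\<close>

lemma form_two_expansion:
  assumes "form 2 f"
  obtains I J where "\<And>m. m \<in> Poly_Mapping.keys f \<Longrightarrow> m = pair_monom (I m) (J m)"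
    and "\<And>v. mpoly_eval f v = (\<Sum>m\<in>Poly_Mapping.keys f. Poly_Mapping.lookup f m * (v $ I m * v $ J m))"
proof -
  have "\<forall>m\<in>Poly_Mapping.keys f. \<exists>i j. m = pair_monom i j"
    using assms degree_two_monom unfolding form_def by metis
  then obtain I J where IJ: "\<And>m. m \<in> Poly_Mapping.keys f \<Longrightarrow> m = pair_monom (I m) (J m)"
    by metis
  have mono: "(\<Prod>k\<in>UNIV. (v $ k) ^ Poly_Mapping.lookup (pair_monom i j) k) = v $ i * v $ j"
    for v :: "'b ^ 'a" and i j
  proof -
    have *: "(\<Prod>k\<in>UNIV. (v $ k) ^ (1 when j = k)) = v $ j" for j
      using mpoly_eval_var[of j v] by (simp add: var_def mpoly_eval_single lookup_single)
    show ?thesis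
      using *[of i] *[of j]
      by (simp add: pair_monom_def lookup_add lookup_single power_add prod.distrib)
  qed
  have "mpoly_eval f v = (\<Sum>m\<in>Poly_Mapping.keys f. Poly_Mapping.lookup f m * (v $ I m * v $ J m))" for v
    unfolding mpoly_eval_def using IJ mono by (intro sum.cong) (metis)+
  with IJ show thesis using that by blast
qed

lemma quadratic_map_mpoly_eval:
  assumes "form 2 f"
  shows "quadratic_map (mpoly_eval f)"
proof -
  obtain I J where E: "\<And>v. mpoly_eval f v =
      (\<Sum>m\<in>Poly_Mapping.keys f. Poly_Mapping.lookup f m * (v $ I m * v $ J m))"
    using form_two_expansion[OF assms] by metis
  have P: "polar (mpoly_eval f) x y = (\<Sum>m\<in>Poly_Mapping.keys f. Poly_Mapping.lookup f m *
      (x $ I m * y $ J m + y $ I m * x $ J m))" for x y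
    unfolding polar_def E sum_subtractf[symmetric]
    by (intro sum.cong) (auto simp: algebra_simps)
  show ?thesis
    by unfold_locales
      (auto simp: P E sum_distrib_left sum.distrib[symmetric] algebra_simps power2_eq_square
        intro!: sum.cong)
qed

text \<open>At a unit vector only the square of its own indeterminate survives, and the polar form
  of two distinct unit vectors isolates one mixed monomial. Thus the values of the form determine
  its coefficients.\<close>

lemma form_two_coeff:
  fixes f :: "('n::finite, 'a::field) mpoly"
  assumes "form 2 f"
  shows "Poly_Mapping.lookup f (pair_monom i j) =
    (if i = j then mpoly_eval f (axis i 1) else polar (mpoly_eval f) (axis i 1) (axis j 1))"
proof -
  obtain I J where IJ: "\<And>m. m \<in> Poly_Mapping.keys f \<Longrightarrow> m = pair_monom (I m) (J m)"
    and E: "\<And>v. mpoly_eval f v =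
      (\<Sum>m\<in>Poly_Mapping.keys f. Poly_Mapping.lookup f m * (v $ I m * v $ J m))"
    using form_two_expansion[OF assms] by metis
  have P: "polar (mpoly_eval f) x y = (\<Sum>m\<in>Poly_Mapping.keys f. Poly_Mapping.lookup f m *
      (x $ I m * y $ J m + y $ I m * x $ J m))" for x y
    unfolding polar_def E sum_subtractf[symmetric]
    by (intro sum.cong) (auto simp: algebra_simps)
  have L: "Poly_Mapping.lookup f n =
      (\<Sum>m\<in>Poly_Mapping.keys f. if m = n then Poly_Mapping.lookup f m else 0)" for n
    by (simp add: in_keys_iff)
  have eq: "m = pair_monom i j \<longleftrightarrow> I m = i \<and> J m = j \<or> I m = j \<and> J m = i"
    if "m \<in> Poly_Mapping.keys f" for m
    using IJ[OF that] pair_monom_eq_iff by metis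
  show ?thesis
  proof (cases "i = j")
    case True
    then show ?thesis
      unfolding L[of "pair_monom i j"] E using eq by (auto simp: axis_def intro!: sum.cong)
  next
    case False
    then show ?thesis
      unfolding L[of "pair_monom i j"] P using eq by (auto simp: axis_def intro!: sum.cong)
  qed
qed

text \<open>Distinct polynomials over a finite field can define the same function; for forms of
  degree two this is excluded, over every field, by the recovery of coefficients from
  values.\<close>

lemma form_two_eqI:
  fixes f g :: "('n::finite, 'a::field) mpoly"
  assumes "form 2 f" "form 2 g" "\<And>v. mpoly_eval f v = mpoly_eval g v"
  shows "f = g"
proof (rule poly_mapping_eqI)
  have eq: "mpoly_eval f = mpoly_eval g" using assms(3) by auto
  fix m
  consider i j where "m = pair_monom i j" | "m \<notin> Poly_Mapping.keys f" "m \<notin> Poly_Mapping.keys g"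
    using assms(1,2) degree_two_monom unfolding form_def by metis
  then show "Poly_Mapping.lookup f m = Poly_Mapping.lookup g m"
  proof cases
    case 1
    then show ?thesis using form_two_coeff[OF assms(1)] form_two_coeff[OF assms(2)] eq by simp
  qed (simp add: in_keys_iff)
qed

text \<open>If \<open>v\<close> were in the radical, a change of coordinates with \<open>v\<close> as a basis vector would eliminate
  the corresponding indeterminate.\<close>

lemma form_rank_radical:
  fixes f :: "('n::finite, 'a::field) mpoly"
  assumes f: "form 2 f" and rank: "form_rank f = CARD('n)"
    and v: "v \<noteq> 0" "mpoly_eval f v = 0"
  shows "\<exists>w. polar (mpoly_eval f) v w \<noteq> 0"
proof (rule ccontr)
  assume "\<not> ?thesis"
  then have rad: "polar (mpoly_eval f) v w = 0" for w by simp
  interpret f: quadratic_map "mpoly_eval f" by (rule quadratic_map_mpoly_eval[OF f])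
  obtain k where k: "v $ k \<noteq> 0" using v(1) by (auto simp: vec_eq_iff)
  \<comment> \<open>The identity matrix with column \<open>k\<close> replaced by \<open>v\<close>:
    it sends the \<open>k\<close>-th unit vector to \<open>v\<close>, and is invertible because
    \<open>v $ k\<close> is nonzero.\<close>
  define A :: "'a ^ 'n ^ 'n" where "A = (\<chi> i j. if j = k then v $ i else if i = j then 1 else 0)"
  have A: "A *v x = (\<chi> i. (if i = k then 0 else x $ i) + x $ k * v $ i)" for x
  proof -
    have "(\<Sum>j\<in>UNIV. A $ i $ j * x $ j) = (if i = k then 0 else x $ i) + x $ k * v $ i" for i
    proof -
      have "(\<Sum>j\<in>UNIV. A $ i $ j * x $ j) =
          (\<Sum>j\<in>UNIV. (if j = k then x $ k * v $ i else 0) +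
            (if j = i then (if i = k then 0 else x $ i) else 0))"
        by (rule sum.cong) (auto simp: A_def)
      then show ?thesis by (simp add: sum.distrib)
    qed
    then show ?thesis by (simp add: matrix_vector_mult_def)
  qed
  have "x = 0" if "A *v x = 0" for x
  proof -
    have e: "(if i = k then 0 else x $ i) + x $ k * v $ i = 0" for i
      using that unfolding A by (simp add: vec_eq_iff)
    from e[of k] k have "x $ k = 0" by simp
    then have "x $ i = 0" for i using e[of i] by (cases "i = k") auto
    then show ?thesis by (simp add: vec_eq_iff)
  qed
  then have inv: "invertible A"
    using matrix_left_invertible_ker invertible_left_inverse by metis
  define h where "h = linear_subst A f"
  have h: "form 2 h" unfolding h_def by (rule form_linear_subst[OF f])
  have eh: "mpoly_eval h x = mpoly_eval f (A *v x)" for x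
    by (simp add: h_def mpoly_eval_linear_subst)
  have Ak: "A *v axis k 1 = v"
    unfolding A by (auto simp: vec_eq_iff axis_def)
  have "k \<notin> indets h"
  proof
    assume "k \<in> indets h"
    then obtain m where m: "m \<in> Poly_Mapping.keys h" "k \<in> Poly_Mapping.keys m"
      by (auto simp: indets_def)
    then obtain i j where ij: "m = pair_monom i j"
      using h degree_two_monom unfolding form_def by metis
    with m(2) have "i = k \<or> j = k"
      by (auto simp: pair_monom_def in_keys_iff lookup_add lookup_single when_def split: if_splits)
    then obtain j where j: "m = pair_monom k j"
      using ij by (auto simp: pair_monom_def add.commute)
    \<comment> \<open>The coefficient of a mixed monomial containing the \<open>k\<close>-th
      indeterminate is a polar value at \<open>v\<close>, and that of its square is the value at
      \<open>v\<close>; both are 0.\<close>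
    have "polar (mpoly_eval h) (axis k 1) (axis j 1) = polar (mpoly_eval f) v (A *v axis j 1)"
      by (simp add: polar_def eh matrix_vector_right_distrib Ak)
    then have "Poly_Mapping.lookup h m = 0"
      using Ak v(2) by (auto simp: j form_two_coeff[OF h] eh rad)
    with m(1) show False by (simp add: in_keys_iff)
  qed
  then have "card (indets h) < CARD('n)"
    by (intro psubset_card_mono) auto
  moreover have "form_rank f \<le> card (indets h)"
    unfolding form_rank_def h_def by (rule Least_le) (use inv in blast)
  ultimately show False using rank by simp
qed

section \<open>Hyperbolic frames\<close>

lemma mem_span_singleton: "y \<in> vec.span {x} \<longleftrightarrow> (\<exists>k. y = k *s x)"
  by (auto simp: vec.span_singleton)

lemma span_singleton_eqD:
  assumes "vec.span {x} = vec.span {y}"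
  shows "\<exists>k. y = k *s x"
  using assms vec.span_base[of y "{y}"] by (auto simp: mem_span_singleton)

lemma span_singleton_scale:
  fixes x :: "'a::field ^ 'n"
  assumes "k \<noteq> 0"
  shows "vec.span {k *s x} = vec.span {x}"
proof (intro equalityI vec.span_minimal vec.subspace_span)
  have "x = (1 / k) *s (k *s x)" using assms by (simp add: vec.scale_scale)
  then have "x \<in> vec.span {k *s x}" unfolding mem_span_singleton by blast
  then show "{x} \<subseteq> vec.span {k *s x}" by simp
qed (auto simp: mem_span_singleton)

lemma proj_points_eq: "proj_points = {vec.span {x} | x :: 'a::field ^ 'n. x \<noteq> 0}"
proof (intro equalityI subsetI)
  fix L :: "('a ^ 'n) set" assume "L \<in> proj_points"
  then have L: "vec.subspace L" "vec.dim L = 1" by (auto simp: proj_points_def)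
  obtain B where B: "B \<subseteq> L" "vec.independent B" "L \<subseteq> vec.span B" "card B = 1"
    using vec.basis_exists[of L] L(2) by metis
  then obtain x where x: "B = {x}" by (auto simp: card_1_singleton_iff)
  moreover have "vec.span B \<subseteq> L" using B(1) L(1) by (rule vec.span_minimal)
  ultimately show "L \<in> {vec.span {x} | x. x \<noteq> 0}"
    using B vec.dependent_zero[of B] by auto
qed (auto simp: proj_points_def vec.dim_eq_card_independent)

text \<open>By homogeneity, vanishing on a whole line is the same as vanishing at a
  generator.\<close>

lemma zero_set_eq:
  assumes "quadratic_map (mpoly_eval f)"
  shows "zero_set f = {vec.span {x} | x. x \<noteq> 0 \<and> mpoly_eval f x = 0}"
proof -
  interpret quadratic_map "mpoly_eval f" by fact
  have "(\<forall>v\<in>vec.span {x}. mpoly_eval f v = 0) \<longleftrightarrow> mpoly_eval f x = 0" for x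
    using vec.span_base[of x "{x}"] by (auto simp: mem_span_singleton scale)
  then show ?thesis
    unfolding zero_set_def proj_points_eq by blast
qed

section \<open>Splitting off hyperbolic planes\<close>

context quadratic_map
begin

definition perp :: "'a ^ 'n \<Rightarrow> 'a ^ 'n \<Rightarrow> ('a ^ 'n) set" where
  "perp v w = {x. polar Q x v = 0 \<and> polar Q x w = 0}"

text \<open>Rescale \<open>w\<close> to pair to 1 with \<open>v\<close>, then add the multiple of
  \<open>v\<close> that cancels its value; the pairing is unchanged as \<open>v\<close> is
  isotropic. The explicit combination shows that the partner stays in any subspace containing
  \<open>v\<close> and \<open>w\<close>.\<close>

lemma hyperbolic_partner:
  assumes "Q v = 0" "polar Q v w \<noteq> 0"
  obtains w' a b where "Q w' = 0" "polar Q v w' = 1" "w' = a *s v + b *s w"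
proof -
  define u where "u = (1 / polar Q v w) *s w"
  have u: "polar Q v u = 1" using assms(2) by (simp add: u_def polar_scale_right)
  define c where "c = - Q u"
  have "Q (c *s v + u) = c + Q u" "polar Q v (c *s v + u) = 1"
    using assms(1) u by (simp_all add: add scale polar_linear polar_self)
  then show thesis using that[of "c *s v + u" c "1 / polar Q v w"] by (simp add: c_def u_def)
qed

text \<open>Pairing with \<open>w\<close> and \<open>v\<close> forces the coefficients of
  \<open>v\<close> and \<open>w\<close>; what remains after subtraction is orthogonal to
  both.\<close>

lemma hyperbolic_split:
  assumes "Q v = 0" "Q w = 0" "polar Q v w = 1"
  obtains y where "y \<in> perp v w" "x = polar Q x w *s v + polar Q x v *s w + y"
proof
  let ?y = "x - (polar Q x w *s v + polar Q x v *s w)"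
  have y: "x = polar Q x w *s v + polar Q x v *s w + ?y" by simp
  show "x = polar Q x w *s v + polar Q x v *s w + ?y" by (rule y)
  show "?y \<in> perp v w"
    using assms polar_commute[of w v]
    by (simp add: perp_def polar_diff_left polar_add_left polar_scale_left polar_self)
qed

lemma quadratic_split:
  assumes "Q v = 0" "Q w = 0" "polar Q v w = 1" "y \<in> perp v w"
  shows "Q (a *s v + b *s w + y) = a * b + Q y"
  using assms by (simp add: perp_def add scale polar_linear polar_commute[of _ y])

end

text \<open>Two mutually orthogonal hyperbolic pairs. Linear independence is not assumed: it follows
  from the pairings.\<close>

locale hyperbolic_frame = quadratic_map Q for Q :: "'a::{field,finite} ^ 4 \<Rightarrow> 'a" +
  fixes e1 e2 e3 e4 :: "'a ^ 4"
  assumes isotropic: "Q e1 = 0" "Q e2 = 0" "Q e3 = 0" "Q e4 = 0"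
    and polars: "polar Q e1 e2 = 1" "polar Q e3 e4 = 1" "polar Q e1 e3 = 0" "polar Q e1 e4 = 0"
      "polar Q e2 e3 = 0" "polar Q e2 e4 = 0"
begin

definition point :: "'a \<Rightarrow> 'a \<Rightarrow> 'a \<Rightarrow> 'a \<Rightarrow> 'a ^ 4" where
  "point a b c d = a *s e1 + b *s e2 + c *s e3 + d *s e4"

lemma Q_point: "Q (point a b c d) = a * b + c * d"
  by (simp add: point_def add scale polar_linear isotropic polars)

lemma polar_point:
  "polar Q (point a b c d) e2 = a" "polar Q (point a b c d) e1 = b"
  "polar Q (point a b c d) e4 = c" "polar Q (point a b c d) e3 = d"
  by (simp_all add: point_def polar_linear polar_self isotropic polars
      polar_commute[of e2 e1] polar_commute[of e3 e1] polar_commute[of e3 e2]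
      polar_commute[of e4 e1] polar_commute[of e4 e2] polar_commute[of e4 e3])

lemma point_eq_iff: "point a b c d = point a' b' c' d' \<longleftrightarrow> a = a' \<and> b = b' \<and> c = c' \<and> d = d'"
  by (metis polar_point)

text \<open>The polar form recovers the coordinates, so \<open>point\<close> is injective, and the
  space has exactly as many vectors as there are coordinate quadruples.\<close>

lemma point_surj: obtains a b c d where "x = point a b c d"
proof -
  let ?f = "\<lambda>(a, b, c, d). point a b c d"
  have "inj ?f" by (auto simp: inj_def point_eq_iff)
  then have "card (range ?f) = CARD('a \<times> 'a \<times> 'a \<times> 'a)" by (rule card_image)
  then have "card (range ?f) = CARD('a ^ 4)" by (simp add: power4_eq_xxxx)
  then have "range ?f = UNIV" by (intro card_subset_eq) auto
  then obtain t where "x = ?f t" by (metis surjD)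
  then show thesis using that by (cases t) auto
qed

lemma point_scale: "k *s point a b c d = point (k * a) (k * b) (k * c) (k * d)"
  by (simp add: point_def vec.scale_right_distrib vec.scale_scale)

lemma point_zero: "point 0 0 0 0 = 0"
  by (simp add: point_def)

end

text \<open>An isotropic vector outside the radical yields a hyperbolic pair. The point count forces
  an isotropic vector in the orthogonal complement as well, and this vector yields the second
  pair.\<close>

lemma hyperbolic_frame_exists:
  fixes Q :: "'a::{field,finite} ^ 4 \<Rightarrow> 'a"
  assumes "quadratic_map Q"
    and nondeg: "\<And>v. v \<noteq> 0 \<Longrightarrow> Q v = 0 \<Longrightarrow> \<exists>w. polar Q v w \<noteq> 0"
    and many: "card {vec.span {x} | x. x \<noteq> 0 \<and> Q x = 0} > CARD('a)\<^sup>2 + 1"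
  obtains e1 e2 e3 e4 where "hyperbolic_frame Q e1 e2 e3 e4"
proof -
  interpret quadratic_map Q by fact
  let ?S = "{vec.span {x} | x. x \<noteq> 0 \<and> Q x = 0}"
  have "?S \<noteq> {}" using many by (metis card.empty not_less_zero)
  then obtain v where v: "v \<noteq> 0" "Q v = 0" by auto
  obtain w where vw: "Q v = 0" "Q w = 0" "polar Q v w = 1"
    using nondeg[OF v] hyperbolic_partner[OF v(2)] v(2) by metis
  define W where "W = perp v w"
  \<comment> \<open>Uniqueness of the decomposition along \<open>v\<close>, \<open>w\<close> and
    \<open>W\<close> gives q^2 |W| <= q^4, hence |W| <= q^2.\<close>
  have "a = a' \<and> b = b' \<and> y = y'"
    if y: "y \<in> W" "y' \<in> W" and eq: "a *s v + b *s w + y = a' *s v + b' *s w + y'"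
    for a b y a' b' y'
  proof -
    have "polar Q (a *s v + b *s w + y) w = a" "polar Q (a *s v + b *s w + y) v = b"
      if "y \<in> W" for a b y
      using that vw polar_commute[of w v]
      by (simp_all add: W_def perp_def polar_linear polar_self)
    with y eq have "a = a'" "b = b'" by metis+
    with eq show ?thesis by simp
  qed
  then have "inj_on (\<lambda>(a, b, y). a *s v + b *s w + y) (UNIV \<times> UNIV \<times> W)"
    unfolding inj_on_def by fast
  then have "card (UNIV \<times> UNIV \<times> W :: ('a \<times> 'a \<times> ('a ^ 4)) set) \<le> CARD('a ^ 4)"
    by (rule card_inj_on_le) auto
  then have cardW: "card W \<le> CARD('a)\<^sup>2"
    by (simp add: card_cartesian_product power4_eq_xxxx power2_eq_square)
  have "\<exists>z\<in>W. z \<noteq> 0 \<and> Q z = 0"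
  proof (rule ccontr)
    assume "\<not> ?thesis"
    then have aniso: "z = 0" if "z \<in> W" "Q z = 0" for z using that by auto
    \<comment> \<open>An anisotropic complement would make \<open>Q\<close> elliptic, with only \<open>q\<^sup>2 + 1\<close> points:
      off \<open>v\<close>, a point is normalised to have coefficient 1 at \<open>w\<close>, and is then given by its
      component in \<open>W\<close>.\<close>
    have "?S \<subseteq> insert (vec.span {v}) ((\<lambda>y. vec.span {(- Q y) *s v + w + y}) ` W)"
    proof clarify
      fix x assume x: "x \<noteq> 0" "Q x = 0"
        and no: "vec.span {x} \<notin> (\<lambda>y. vec.span {(- Q y) *s v + w + y}) ` W"
      obtain a b y where y: "y \<in> W" "x = a *s v + b *s w + y"
        using hyperbolic_split[OF vw, of x] unfolding W_def by metis
      have ab: "a * b + Q y = 0" using quadratic_split[OF vw] y x unfolding W_def by metis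
      show "vec.span {x} = vec.span {v}"
      proof (cases "b = 0")
        case True
        with ab aniso[OF y(1)] have "x = a *s v" using y(2) by simp
        then show ?thesis using x(1) span_singleton_scale[of a v] by auto
      next
        case False
        define z where "z = (1 / b) *s y"
        have z: "z \<in> W" using y(1) by (simp add: z_def W_def perp_def polar_linear)
        have "a = - (Q y / b)"
          using ab False by (simp add: field_simps eq_neg_iff_add_eq_0)
        then have "x = b *s ((- Q z) *s v + w + z)"
          using False by (simp add: y(2) z_def scale vec.scale_right_distrib vec.scale_scale
              power2_eq_square)
        then have "vec.span {x} = vec.span {(- Q z) *s v + w + z}"
          using span_singleton_scale[OF False] by metis
        with z no show ?thesis by blast
      qed
    qed
    then have "card ?S \<le> card (insert (vec.span {v}) ((\<lambda>y. vec.span {(- Q y) *s v + w + y}) ` W))"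
      by (rule card_mono[rotated]) simp
    also have "\<dots> \<le> Suc (card W)"
      using card_image_le[of W "\<lambda>y. vec.span {(- Q y) *s v + w + y}"] by (simp add: card_insert_if)
    finally show False using many cardW by simp
  qed
  then obtain z where z: "z \<in> W" "z \<noteq> 0" "Q z = 0" by auto
  \<comment> \<open>The partner of \<open>z\<close> has to lie in \<open>W\<close>. Nondegeneracy
    gives some \<open>u\<close> in the whole space; since \<open>z\<close> is orthogonal to
    \<open>v\<close> and \<open>w\<close>, the component of \<open>u\<close> in \<open>W\<close>
    pairs with \<open>z\<close> as \<open>u\<close> does.\<close>
  obtain u where u: "polar Q z u \<noteq> 0" using nondeg[OF z(2,3)] by auto
  obtain t where t: "t \<in> W" "u = polar Q u w *s v + polar Q u v *s w + t"
    using hyperbolic_split[OF vw, of u] unfolding W_def by metis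
  have "polar Q z u = polar Q z (polar Q u w *s v + polar Q u v *s w + t)"
    by (rule arg_cong[OF t(2)])
  also have "\<dots> = polar Q z t" using z(1) by (simp add: W_def perp_def polar_linear)
  finally have "polar Q z t \<noteq> 0" using u by simp
  then obtain y a b where y: "Q y = 0" "polar Q z y = 1" "y = a *s z + b *s t"
    using hyperbolic_partner[OF z(3)] by metis
  have "y \<in> W" using z t unfolding y(3) by (simp add: W_def perp_def polar_linear)
  have "polar Q v x = 0" "polar Q w x = 0" if "x \<in> W" for x
    using that polar_commute[of x v] polar_commute[of x w] by (simp_all add: W_def perp_def)
  then have "hyperbolic_frame Q v w z y"
    using vw y(1,2) z \<open>y \<in> W\<close> by unfold_locales simp_all
  then show thesis by (rule that)
qed

section \<open>Counting points along the rulings\<close>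

text \<open>One normalised vector per point, with first nonzero coordinate 1, so that forms can be
  evaluated directly at points.\<close>

definition proj_line :: "('a::field \<times> 'a) set" where
  "proj_line = insert (0, 1) (range (\<lambda>x. (1, x)))"

lemma finite_proj_line [simp]: "finite (proj_line :: ('a::{field,finite} \<times> 'a) set)"
  by (simp add: proj_line_def)

lemma card_proj_line: "card (proj_line :: ('a::{field,finite} \<times> 'a) set) = CARD('a) + 1"
proof -
  have "card (range (\<lambda>x::'a. (1::'a, x))) = CARD('a)" by (rule card_image) (auto simp: inj_on_def)
  then show ?thesis unfolding proj_line_def by (subst card_insert_disjoint) auto
qed

text \<open>Distinct normalised vectors are not proportional, so their determinant is
  nonzero.\<close>

lemma proj_line_det:
  assumes "r \<in> proj_line" "r' \<in> proj_line" "r \<noteq> r'"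
  shows "fst r * snd r' - snd r * fst r' \<noteq> 0"
  using assms by (auto simp: proj_line_def)

lemma proj_line_rep:
  fixes s t :: "'a::field"
  assumes "(s, t) \<noteq> (0, 0)"
  obtains k r where "k \<noteq> 0" "r \<in> proj_line" "s = k * fst r" "t = k * snd r"
proof (cases "s = 0")
  case True
  then show thesis using assms that[of t "(0, 1)"] by (auto simp: proj_line_def)
next
  case False
  then show thesis using that[of s "(1, t / s)"] by (auto simp: proj_line_def)
qed

section \<open>Zeros of binary quadratic forms\<close>

definition binary_form :: "'a::field \<Rightarrow> 'a \<Rightarrow> 'a \<Rightarrow> 'a \<times> 'a \<Rightarrow> 'a" where
  "binary_form a b c r = a * (fst r)\<^sup>2 + b * (fst r * snd r) + c * (snd r)\<^sup>2"

lemma binary_form_two_zeros: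
  fixes a b c :: "'a::field"
  assumes p: "p \<in> proj_line" "p' \<in> proj_line" "p \<noteq> p'"
    and zero: "binary_form a b c p = 0" "binary_form a b c p' = 0"
  obtains m where "\<And>r. binary_form a b c r =
    m * ((fst r * snd p - snd r * fst p) * (fst r * snd p' - snd r * fst p'))"
proof -
  \<comment> \<open>At most one of two distinct points is (0, 1), so by symmetry the first may be
    taken as (1, x).\<close>
  have *: "\<exists>m. \<forall>r. binary_form a b c r =
    m * ((fst r * snd p - snd r * fst p) * (fst r * snd p' - snd r * fst p'))"
    if p: "p' \<in> proj_line" "p \<noteq> p'"
      and zero: "binary_form a b c p = 0" "binary_form a b c p' = 0"
      and px: "p = (1, x)" for p p' x
  proof (cases "p' = (0, 1)")
    case True
    then have "c = 0" "a = - b * x"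
      using zero px by (auto simp: binary_form_def eq_neg_iff_add_eq_0)
    then show ?thesis using True px
      by (intro exI[of _ "- b"]) (auto simp: binary_form_def algebra_simps power2_eq_square)
  next
    case False
    then obtain y where y: "p' = (1, y)" using p by (auto simp: proj_line_def)
    have "x \<noteq> y" using p y px by auto
    \<comment> \<open>Dividing the difference of the two equations by x - y gives Vieta's relations:
      b = -c(x + y) and then a = cxy.\<close>
    moreover have "(x - y) * (b + c * (x + y)) = binary_form a b c p - binary_form a b c p'"
      by (simp add: y px binary_form_def power2_eq_square algebra_simps)
    ultimately have "b + c * (x + y) = 0" using zero by simp
    then have b: "b = - c * (x + y)" by (simp add: eq_neg_iff_add_eq_0)
    have "a - c * x * y = binary_form a b c p"
      by (simp add: px b binary_form_def power2_eq_square algebra_simps)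
    then have a: "a = c * x * y" using zero by simp
    show ?thesis
      unfolding a b using y px
      by (intro exI[of _ c]) (auto simp: binary_form_def algebra_simps power2_eq_square)
  qed
  from p consider x where "p = (1, x)" | x where "p' = (1, x)" by (auto simp: proj_line_def)
  then show thesis
  proof cases
    case 1
    then show thesis using *[OF p(2,3) zero] that by blast
  next
    case 2
    then show thesis
      using *[OF p(1) p(3)[symmetric] zero(2,1)] that by (metis mult.commute)
  qed
qed

text \<open>Two zeros force a factorisation into linear factors. Neither factor vanishes at a third
  point, so the scalar in front is 0.\<close>

lemma binary_form_three_zeros:
  fixes a b c :: "'a::field"
  assumes p: "p1 \<in> proj_line" "p2 \<in> proj_line" "p3 \<in> proj_line" "p1 \<noteq> p2" "p1 \<noteq> p3" "p2 \<noteq> p3"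
    and zero: "binary_form a b c p1 = 0" "binary_form a b c p2 = 0" "binary_form a b c p3 = 0"
  shows "binary_form a b c r = 0"
proof -
  obtain m where m: "\<And>r. binary_form a b c r =
      m * ((fst r * snd p1 - snd r * fst p1) * (fst r * snd p2 - snd r * fst p2))"
    using binary_form_two_zeros[OF p(1,2,4) zero(1,2)] by metis
  have "m = 0"
    using m[of p3] zero(3) proj_line_det[of p3 p1] proj_line_det[of p3 p2] p by auto
  then show ?thesis by (simp add: m)
qed

lemma card_ge_3_obtain:
  assumes "\<not> card A \<le> 2"
  obtains x y z where "x \<in> A" "y \<in> A" "z \<in> A" "x \<noteq> y" "x \<noteq> z" "y \<noteq> z"
proof -
  from assms have "Suc (Suc (Suc 0)) \<le> card A" by simp
  then obtain x y z B where "A = insert x (insert y (insert z B))" "x \<noteq> y" "x \<noteq> z" "y \<noteq> z"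
    unfolding card_le_Suc_iff by auto
  then show thesis using that by auto
qed

lemma card_binary_form_zeros:
  fixes a b c :: "'a::{field,finite}"
  assumes "\<not> (\<forall>r\<in>proj_line. binary_form a b c r = 0)"
  shows "card {r \<in> proj_line. binary_form a b c r = 0} \<le> 2"
proof (rule ccontr)
  assume "\<not> ?thesis"
  then show False
  proof (rule card_ge_3_obtain)
    fix x y z assume "x \<in> {r \<in> proj_line. binary_form a b c r = 0}"
      "y \<in> {r \<in> proj_line. binary_form a b c r = 0}" "z \<in> {r \<in> proj_line. binary_form a b c r = 0}"
      "x \<noteq> y" "x \<noteq> z" "y \<noteq> z"
    then show False using binary_form_three_zeros[of x y z a b c] assms by auto
  qed
qed

section \<open>Counting zeros by fibres\<close>

text \<open>The assumption \<open>const\<close> holds for a form of bidegree (2,2) because, for fixed \<open>w\<close>, a binary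
  quadratic form in \<open>r\<close> with zeros \<open>p\<close> and \<open>p'\<close> that vanishes at a third point is zero.\<close>

lemma card_biquadratic_zeros:
  fixes R :: "'b set" and Z :: "'b \<Rightarrow> 'b \<Rightarrow> bool"
  assumes R: "card R = q + 1" and q: "q \<ge> 2"
    and fibre: "\<And>r. r \<in> R \<Longrightarrow> \<not> (\<forall>w\<in>R. Z r w) \<Longrightarrow> card {w\<in>R. Z r w} \<le> 2"
    and full: "card {r\<in>R. \<forall>w\<in>R. Z r w} \<le> 2"
    and const: "\<And>p p' r r' w. \<lbrakk>p \<in> R; p' \<in> R; p \<noteq> p'; \<forall>w\<in>R. Z p w; \<forall>w\<in>R. Z p' w;
      r \<in> R - {p, p'}; r' \<in> R - {p, p'}; w \<in> R; Z r w\<rbrakk> \<Longrightarrow> Z r' w"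
  defines "N \<equiv> card {(r, w). r \<in> R \<and> w \<in> R \<and> Z r w}"
  shows "N = 4 * q \<or> N = 3 * q + 1 \<or> N \<le> 3 * q"
proof -
  \<comment> \<open>\<open>K\<close> collects the full fibres, each contributing q + 1; every other
    fibre contributes at most 2.\<close>
  define K where "K = {r\<in>R. \<forall>w\<in>R. Z r w}"
  define n where "n r = card {w\<in>R. Z r w}" for r
  have fin: "finite R" using R by (metis Suc_eq_plus1 card.infinite nat.distinct(1))
  have "{(r, w). r \<in> R \<and> w \<in> R \<and> Z r w} = (SIGMA r:R. {w\<in>R. Z r w})" by auto
  then have "N = (\<Sum>r\<in>R. n r)" using fin by (simp add: N_def n_def)
  also have "\<dots> = (\<Sum>r\<in>R - K. n r) + (\<Sum>r\<in>K. n r)"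
    by (rule sum.subset_diff) (auto simp: K_def fin)
  also have "(\<Sum>r\<in>K. n r) = (\<Sum>r\<in>K. q + 1)"
  proof (rule sum.cong)
    fix r assume "r \<in> K"
    then have "{w\<in>R. Z r w} = R" by (auto simp: K_def)
    then show "n r = q + 1" by (simp add: n_def R)
  qed simp
  finally have N: "N = (\<Sum>r\<in>R - K. n r) + card K * (q + 1)" by simp
  have n2: "n r \<le> 2" if "r \<in> R - K" for r
    using that fibre unfolding K_def n_def by auto
  have cRK: "card (R - K) = q + 1 - card K"
    using R fin by (subst card_Diff_subset) (auto simp: K_def)
  have le: "(\<Sum>r\<in>R - K. n r) \<le> (q + 1 - card K) * 2"
    using sum_bounded_above[of "R - K" n 2] n2 cRK by simp
  have "card K \<le> 2" using full by (simp add: K_def)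
  then consider "card K = 0" | "card K = 1" | "card K = 2" by linarith
  then show ?thesis
  proof cases
    case 1
    \<comment> \<open>Here N <= 2(q + 1) <= 3q, because q >= 2.\<close>
    then show ?thesis using N le q by auto
  next
    case 2
    then show ?thesis using N le q by auto
  next
    case 3
    then obtain p p' where p: "K = {p, p'}" "p \<noteq> p'" by (auto simp: card_2_iff)
    then have pR: "p \<in> R" "p' \<in> R" "\<forall>w\<in>R. Z p w" "\<forall>w\<in>R. Z p' w" by (auto simp: K_def)
    have "card (R - K) > 0" using cRK 3 q by simp
    then obtain r0 where r0: "r0 \<in> R - K" by (metis card_gt_0_iff ex_in_conv)
    have "n r = n r0" if r: "r \<in> R - K" for r
    proof -
      have "{w\<in>R. Z r w} = {w\<in>R. Z r0 w}"
        using const[OF pR(1,2) p(2) pR(3,4)] r r0 unfolding p(1) by blast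
      then show ?thesis by (simp add: n_def)
    qed
    \<comment> \<open>The common fibre size 0, 1 or 2 gives N = 2q + 2, 3q + 1 or 4q, the first
      being at most 3q.\<close>
    then have "N = (q - 1) * n r0 + 2 * (q + 1)" using N 3 cRK by simp
    moreover have "n r0 = 0 \<or> n r0 = 1 \<or> n r0 = 2" using n2[OF r0] by linarith
    ultimately show ?thesis using q by auto
  qed
qed

section \<open>The Segre parametrisation of the quadric\<close>

context hyperbolic_frame
begin

text \<open>Fixing either argument parametrises the lines of one ruling of the quadric.\<close>

definition segre :: "'a \<times> 'a \<Rightarrow> 'a \<times> 'a \<Rightarrow> 'a ^ 4" where
  "segre r w = point (fst r * fst w) (snd r * snd w) (fst r * snd w) (- (snd r * fst w))"

lemma Q_segre: "Q (segre r w) = 0"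
  by (simp add: segre_def Q_point)

lemma segre_nonzero:
  assumes "r \<in> proj_line" "w \<in> proj_line"
  shows "segre r w \<noteq> 0"
proof
  assume "segre r w = 0"
  then have "segre r w = point 0 0 0 0" by (simp only: point_zero)
  then show False
    using assms unfolding segre_def point_eq_iff by (auto simp: proj_line_def)
qed

text \<open>The coordinates are, up to sign, the products of entries of the two pairs. They fix each
  pair up to a scalar, and normalisation removes that freedom.\<close>

lemma segre_unique:
  assumes "r \<in> proj_line" "w \<in> proj_line" "r' \<in> proj_line" "w' \<in> proj_line"
    and eq: "segre r' w' = k *s segre r w"
  shows "r' = r \<and> w' = w"
proof -
  have "k \<noteq> 0" using segre_nonzero[of r' w'] assms by auto
  then show ?thesis
    using assms unfolding segre_def point_scale point_eq_iff
    by (auto simp: proj_line_def)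
qed

text \<open>The equation ab + cd = 0 says that the matrix with rows (a, c) and (-d, b) is singular.
  It is therefore the outer product of some (s, t) and (u, v), which are then normalised.\<close>

lemma segre_surj:
  assumes "x \<noteq> 0" "Q x = 0"
  obtains k r w where "k \<noteq> 0" "r \<in> proj_line" "w \<in> proj_line" "x = k *s segre r w"
proof -
  obtain a b c d where x: "x = point a b c d" using point_surj by blast
  have ab: "a * b = - (c * d)" using assms(2) x by (simp add: Q_point eq_neg_iff_add_eq_0)
  \<comment> \<open>If the first row is zero, take (s, t) = (0, 1) and the second row for (u, v).
    Otherwise (u, v) is the first row, s = 1, and t is the ratio of the second row to the first,
    computed from a nonzero entry.\<close>
  have "\<exists>s t u v. x = point (s * u) (t * v) (s * v) (- (t * u))"
  proof (cases "a = 0 \<and> c = 0")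
    case True
    then show ?thesis using x by (intro exI[of _ 0] exI[of _ 1] exI[of _ "- d"] exI[of _ b]) simp
  next
    case False
    show ?thesis
    proof (cases "a = 0")
      case True
      then have "c \<noteq> 0" "d = 0" using False ab by auto
      then show ?thesis using x True
        by (intro exI[of _ 1] exI[of _ "b / c"] exI[of _ 0] exI[of _ c]) simp
    next
      case False
      then have "b = - (d / a) * c" using ab by (simp add: field_simps)
      then show ?thesis using x False
        by (intro exI[of _ 1] exI[of _ "- (d / a)"] exI[of _ a] exI[of _ c]) simp
    qed
  qed
  then obtain s t u v where stuv: "x = point (s * u) (t * v) (s * v) (- (t * u))" by blast
  have "(s, t) \<noteq> (0, 0)" "(u, v) \<noteq> (0, 0)" using assms(1) stuv point_zero by auto
  then obtain k r l w where "k \<noteq> 0" "r \<in> proj_line" "s = k * fst r" "t = k * snd r"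
    "l \<noteq> 0" "w \<in> proj_line" "u = l * fst w" "v = l * snd w"
    by (metis proj_line_rep)
  then show thesis
    using that[of "k * l" r w] stuv by (simp add: segre_def point_scale mult_ac)
qed

text \<open>The Segre map is a bijection onto the points of the quadric of Q. Generators of one line
  differ by a scalar, so membership in the quadric of G can be tested on the Segre
  representative.\<close>

lemma card_common_zeros:
  assumes "quadratic_map G"
  shows "card ({vec.span {x} | x. x \<noteq> 0 \<and> Q x = 0} \<inter> {vec.span {x} | x. x \<noteq> 0 \<and> G x = 0}) =
    card {(r, w). r \<in> proj_line \<and> w \<in> proj_line \<and> G (segre r w) = 0}"
    (is "card ?L = card ?P")
proof (rule sym, rule bij_betw_same_card)
  interpret G: quadratic_map G by fact
  show "bij_betw (\<lambda>(r, w). vec.span {segre r w}) ?P ?L"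
    unfolding bij_betw_def
  proof
    show "inj_on (\<lambda>(r, w). vec.span {segre r w}) ?P"
    proof (rule inj_onI)
      fix y z assume y: "y \<in> ?P" and z: "z \<in> ?P"
        and eq: "(\<lambda>(r, w). vec.span {segre r w}) y = (\<lambda>(r, w). vec.span {segre r w}) z"
      obtain r w r' w' where rw: "y = (r, w)" "z = (r', w')"
        by (cases y, cases z) auto
      then have "vec.span {segre r w} = vec.span {segre r' w'}" using eq by simp
      then obtain k where "segre r' w' = k *s segre r w" by (metis span_singleton_eqD)
      then show "y = z" using segre_unique[of r w r' w' k] y z rw by simp
    qed
    show "(\<lambda>(r, w). vec.span {segre r w}) ` ?P = ?L"
    proof (intro equalityI subsetI)
      fix L assume "L \<in> (\<lambda>(r, w). vec.span {segre r w}) ` ?P"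
      then obtain r w where "r \<in> proj_line" "w \<in> proj_line" "G (segre r w) = 0"
        "L = vec.span {segre r w}" by auto
      then show "L \<in> ?L" using segre_nonzero Q_segre by blast
    next
      fix L assume "L \<in> ?L"
      then obtain x y where x: "x \<noteq> 0" "Q x = 0" "L = vec.span {x}"
        and y: "G y = 0" "L = vec.span {y}" by auto
      obtain k r w where k: "k \<noteq> 0" "r \<in> proj_line" "w \<in> proj_line" "x = k *s segre r w"
        using segre_surj x by blast
      have L: "L = vec.span {segre r w}" using x k span_singleton_scale by metis
      then obtain l where "segre r w = l *s y" using y span_singleton_eqD by metis
      then have "G (segre r w) = 0" using y by (simp add: G.scale)
      then show "L \<in> (\<lambda>(r, w). vec.span {segre r w}) ` ?P" using k L by force
    qed
  qed
qed

text \<open>\<open>segre\<close> is bilinear: with \<open>w\<close> fixed it runs through the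
  combinations of the images of (1, 0) and (0, 1), on which G is a binary quadratic form.\<close>

lemma segre_left_form:
  assumes "quadratic_map G"
  obtains a b c where "\<And>r. G (segre r w) = binary_form a b c r"
proof -
  interpret G: quadratic_map G by fact
  define x where "x = segre (1, 0) w"
  define y where "y = segre (0, 1) w"
  have "segre r w = fst r *s x + snd r *s y" for r
    by (simp add: x_def y_def segre_def point_def vec.scale_right_distrib vec.scale_scale
        vec.scale_minus_right mult_ac)
  then have "G (segre r w) = binary_form (G x) (polar G x y) (G y) r" for r
    by (simp add: G.add G.scale G.polar_linear binary_form_def mult_ac)
  then show thesis by (rule that)
qed

lemma segre_right_form:
  assumes "quadratic_map G"
  obtains a b c where "\<And>w. G (segre r w) = binary_form a b c w"
proof -
  interpret G: quadratic_map G by fact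
  define x where "x = segre r (1, 0)"
  define y where "y = segre r (0, 1)"
  have "segre r w = fst w *s x + snd w *s y" for w
    by (simp add: x_def y_def segre_def point_def vec.scale_right_distrib vec.scale_scale
        vec.scale_minus_right mult_ac)
  then have "G (segre r w) = binary_form (G x) (polar G x y) (G y) w" for w
    by (simp add: G.add G.scale G.polar_linear binary_form_def mult_ac)
  then show thesis by (rule that)
qed

text \<open>A few zeros of Q suffice, over any field. The frame vectors and the sums of two
  orthogonal ones kill every coefficient of G except those of ab and cd; the zero (1, 1, 1, -1)
  makes these two equal.\<close>

lemma vanishing_on_zeros:
  assumes "quadratic_map G" and zero: "\<And>x. Q x = 0 \<Longrightarrow> G x = 0"
  obtains k where "\<And>x. G x = k * Q x"
proof -
  interpret G: quadratic_map G by fact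
  have z: "G (point a b c d) = 0" if "a * b + c * d = 0" for a b c d
    using that zero Q_point by simp
  have e: "G e1 = 0" "G e2 = 0" "G e3 = 0" "G e4 = 0"
    using zero isotropic by auto
  have p: "polar G e1 e3 = 0" "polar G e1 e4 = 0" "polar G e2 e3 = 0" "polar G e2 e4 = 0"
    using z[of 1 0 1 0] z[of 1 0 0 1] z[of 0 1 1 0] z[of 0 1 0 1] e
    by (simp_all add: point_def polar_def)
  have G: "G (point a b c d) = a * b * polar G e1 e2 + c * d * polar G e3 e4" for a b c d
    by (simp add: point_def G.add G.scale G.polar_linear e p)
  from z[of 1 1 1 "-1"] have "polar G e3 e4 = polar G e1 e2" by (simp add: G)
  then have "G (point a b c d) = polar G e1 e2 * Q (point a b c d)" for a b c d
    by (simp add: G Q_point algebra_simps)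
  then have "G x = polar G e1 e2 * Q x" for x
    using point_surj[of x] by metis
  then show thesis by (rule that)
qed

lemma card_intersection:
  assumes G: "quadratic_map G" and nz: "\<not> (\<exists>k. \<forall>x. G x = k * Q x)"
  defines "N \<equiv> card {(r, w). r \<in> proj_line \<and> w \<in> proj_line \<and> G (segre r w) = 0}"
  shows "N = 4 * CARD('a) \<or> N = 3 * CARD('a) + 1 \<or> N \<le> 3 * CARD('a)"
  unfolding N_def
proof (rule card_biquadratic_zeros)
  show "card (proj_line :: ('a \<times> 'a) set) = CARD('a) + 1" by (rule card_proj_line)
  have "card {0, 1::'a} \<le> CARD('a)" by (rule card_mono) auto
  then show "2 \<le> CARD('a)" by simp
next
  fix r assume "\<not> (\<forall>w\<in>proj_line. G (segre r w) = 0)"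
  moreover obtain a b c where "\<And>w. G (segre r w) = binary_form a b c w"
    using segre_right_form[OF G] by metis
  ultimately show "card {w \<in> proj_line. G (segre r w) = 0} \<le> 2"
    using card_binary_form_zeros[of a b c] by simp
next
  interpret G: quadratic_map G by fact
  show "card {r \<in> proj_line. \<forall>w\<in>proj_line. G (segre r w) = 0} \<le> 2"
  proof (rule ccontr)
    assume "\<not> ?thesis"
    then obtain p1 p2 p3 where p: "p1 \<in> proj_line" "p2 \<in> proj_line" "p3 \<in> proj_line"
        "p1 \<noteq> p2" "p1 \<noteq> p3" "p2 \<noteq> p3"
      and zero: "\<forall>w\<in>proj_line. G (segre p1 w) = 0" "\<forall>w\<in>proj_line. G (segre p2 w) = 0"
        "\<forall>w\<in>proj_line. G (segre p3 w) = 0"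
      by (rule card_ge_3_obtain) blast
    \<comment> \<open>For each \<open>w\<close>, the binary form in \<open>r\<close> vanishes at
      \<open>p1\<close>, \<open>p2\<close> and \<open>p3\<close>, hence identically. G then vanishes
      on all zeros of Q and is a multiple of Q.\<close>
    have *: "G (segre r w) = 0" if w: "w \<in> proj_line" for r w
    proof -
      obtain a b c where "\<And>r. G (segre r w) = binary_form a b c r"
        using segre_left_form[OF G] by metis
      then show ?thesis using binary_form_three_zeros[OF p] zero w by metis
    qed
    have "G x = 0" if x: "Q x = 0" for x
    proof (cases "x = 0")
      case False
      obtain k r w where "w \<in> proj_line" "x = k *s segre r w"
        using segre_surj[OF False x] by metis
      then show ?thesis using * by (simp add: G.scale)
    qed simp
    then show False using vanishing_on_zeros[OF G] nz by metis
  qed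
next
  fix p p' r r' w :: "'a \<times> 'a"
  assume p: "p \<in> proj_line" "p' \<in> proj_line" "p \<noteq> p'"
    and full: "\<forall>w\<in>proj_line. G (segre p w) = 0" "\<forall>w\<in>proj_line. G (segre p' w) = 0"
    and r: "r \<in> proj_line - {p, p'}" "r' \<in> proj_line - {p, p'}"
    and w: "w \<in> proj_line" "G (segre r w) = 0"
  obtain a b c where B: "\<And>r. G (segre r w) = binary_form a b c r"
    using segre_left_form[OF G] by metis
  have "binary_form a b c p = 0" "binary_form a b c p' = 0" "binary_form a b c r = 0"
    using full w B by metis+
  then have "binary_form a b c r' = 0"
    using binary_form_three_zeros[of p p' r a b c r'] p r by auto
  then show "G (segre r' w) = 0" by (simp add: B)
qed

end

section \<open>From defining forms to quadratic maps\<close>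

theorem proposition6p1:
  fixes f g :: "(4, 'a::{field,finite}) mpoly"
    and q :: nat
    and X Q' :: "('a ^ 4) set set"
  assumes "q = CARD('a)" and "q \<ge> 3"
    and "hyperbolic f" and "X = zero_set f"
    and "quadric_form g" and "Q' = zero_set g"
    and "\<not> proportional f g"
  shows "card (X \<inter> Q') = 4 * q \<or> card (X \<inter> Q') = 3 * q + 1 \<or> card (X \<inter> Q') \<le> 3 * q"
proof -
  have f: "form 2 f" "form_rank f = 4" "card (zero_set f) = (CARD('a) + 1)\<^sup>2"
    using assms(3) by (auto simp: hyperbolic_def quadric_form_def nondegenerate_def)
  have g: "form 2 g" "g \<noteq> 0" using assms(5) by (auto simp: quadric_form_def)
  note qf = quadratic_map_mpoly_eval[OF f(1)] and qg = quadratic_map_mpoly_eval[OF g(1)]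
  have rank: "form_rank f = CARD(4)" using f(2) by simp
  have "CARD('a)\<^sup>2 + 1 < card (zero_set f)"
    unfolding f(3) by (simp add: power2_eq_square)
  then obtain e1 e2 e3 e4 where "hyperbolic_frame (mpoly_eval f) e1 e2 e3 e4"
    unfolding zero_set_eq[OF qf]
    using hyperbolic_frame_exists[OF qf form_rank_radical[OF f(1) rank]] by blast
  then interpret hyperbolic_frame "mpoly_eval f" e1 e2 e3 e4 .
  \<comment> \<open>Proportional functions would come from proportional forms, since values
    determine forms of degree two. The factor would be nonzero because \<open>g\<close> is.\<close>
  have "\<not> (\<exists>k. \<forall>x. mpoly_eval g x = k * mpoly_eval f x)"
  proof
    assume "\<exists>k. \<forall>x. mpoly_eval g x = k * mpoly_eval f x"
    then obtain k where k: "\<And>x. mpoly_eval g x = k * mpoly_eval f x" by blast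
    have "form 2 (const k * f)" using form_mult[OF form_const f(1)] by (metis add_0)
    then have "g = const k * f"
      by (rule form_two_eqI[OF g(1)]) (simp add: k mpoly_eval_mult mpoly_eval_const)
    moreover from this have "k \<noteq> 0" using g(2) by (auto simp: const_def)
    ultimately show False using assms(7) by (auto simp: proportional_def)
  qed
  from card_intersection[OF qg this] show ?thesis
    using card_common_zeros[OF qg]
    unfolding assms(1,4,6) zero_set_eq[OF qf] zero_set_eq[OF qg] by simp
qed

end
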